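(* Let $s, r, k, n_1, \ldots, n_r$ be integers with $2\leq s\leq r$, $k\geq 1$ and $n_1\leq n_2\leq\cdots\leq n_r$. Suppose that $n_1\geq s^3k+sr$ if $s\leq r-2$; $n_1\geq s^3k^2+sr$ if $s=r-1$; and $n_1\geq k$ if $s=r$. Then $$ex_s\left(K_{n_1,n_2,\ldots,n_r}^{(s)},\, kK_s^{(s)}\right)=(k-1)\sum_{\substack{A\subset\{2,\ldots,r\}\\ |A|=s-1}}\ \prod_{i\in A}n_i.$$
   Context: An $s$-uniform hypergraph ($s$-graph) is a hypergraph all of whose edges have exactly $s$ vertices. For two $s$-graphs $H$ and $F$, $H$ is $F$-free if it contains no copy of $F$ as a (not necessarily induced) subgraph, and the Turán number $ex_s(H,F)$ is the maximum number of edges of an $F$-free subgraph of $H$. $K_t^{(s)}$ denotes the complete $s$-graph on $t$ vertices, and $kK_t^{(s)}$ denotes the $s$-graph consisting of $k$ vertex-disjoint copies of $K_t^{(s)}$; in particular $kK_s^{(s)}$ is a matching of size $k$. For disjoint vertex sets $V_1,\ldots,V_r$ with $|V_i|=n_i$, the complete $r$-partite $s$-graph $K_{n_1,\ldots,n_r}^{(s)}$ has vertex set $V_1\cup\cdots\cup V_r$ and its edges are all $s$-element subsets $S$ of $V_1\cup\cdots\cup V_r$ with $|S\cap V_i|\leq 1$ for all $i=1,\ldots,r$. *)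

theory Defs
  imports Main "HOL-Library.Disjoint_Sets"
begin

record 'a hypergraph =
  verts :: "'a set"
  edges :: "'a set set"

definition uniform_hypergraph :: "nat \<Rightarrow> 'a hypergraph \<Rightarrow> bool" where
  "uniform_hypergraph s H \<longleftrightarrow>
     finite (verts H) \<and> (\<forall>e\<in>edges H. e \<subseteq> verts H \<and> card e = s)"

definition subhypergraph :: "'a hypergraph \<Rightarrow> 'a hypergraph \<Rightarrow> bool" where
  "subhypergraph G H \<longleftrightarrow>
     verts G \<subseteq> verts H \<and> edges G \<subseteq> edges H \<and> (\<forall>e\<in>edges G. e \<subseteq> verts G)"

definition isomorphic :: "'a hypergraph \<Rightarrow> 'b hypergraph \<Rightarrow> bool" where
  "isomorphic F G \<longleftrightarrow> (\<exists>f. bij_betw f (verts F) (verts G) \<and> edges G = (\<lambda>e. f ` e) ` edges F)"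

definition free_of :: "'b hypergraph \<Rightarrow> 'a hypergraph \<Rightarrow> bool" where
  "free_of F H \<longleftrightarrow> \<not> (\<exists>G. subhypergraph G H \<and> isomorphic F G)"

text \<open>The set below is finite whenever \<open>H\<close> has finitely many edges, and it contains \<open>0\<close> whenever
  \<open>F\<close> has at least one edge; then \<open>Max\<close> is a genuine maximum.\<close>

definition turan_number :: "nat \<Rightarrow> 'a hypergraph \<Rightarrow> 'b hypergraph \<Rightarrow> nat" where
  "turan_number s H F =
     Max {card (edges G) | G. uniform_hypergraph s G \<and> subhypergraph G H \<and> free_of F G}"

definition complete_hypergraph :: "nat \<Rightarrow> nat \<Rightarrow> nat hypergraph" where
  "complete_hypergraph s t = \<lparr>verts = {..<t}, edges = {e. e \<subseteq> {..<t} \<and> card e = s}\<rparr>"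

text \<open>The \<open>k\<close> vertex-disjoint copies are made disjoint by tagging vertices with the index of the copy.\<close>

definition disjoint_copies :: "nat \<Rightarrow> 'a hypergraph \<Rightarrow> (nat \<times> 'a) hypergraph" where
  "disjoint_copies k F =
     \<lparr>verts = {..<k} \<times> verts F, edges = {Pair i ` e | i e. i < k \<and> e \<in> edges F}\<rparr>"

text \<open>The vertex classes are \<open>V 1, \<dots>, V r\<close>; values of \<open>V\<close> at other indices are ignored.\<close>

definition complete_multipartite :: "nat \<Rightarrow> nat \<Rightarrow> (nat \<Rightarrow> 'a set) \<Rightarrow> 'a hypergraph" where
  "complete_multipartite s r V =
     \<lparr>verts = (\<Union>i\<in>{1..r}. V i),
      edges = {e. e \<subseteq> (\<Union>i\<in>{1..r}. V i) \<and> card e = s \<and> (\<forall>i\<in>{1..r}. card (e \<inter> V i) \<le> 1)}\<rparr>"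

end

theory Submission
  imports Defs "HOL-Library.FuncSet"
begin

text \<open>
  Being free of \<open>k\<close> disjoint edges means having no matching of size \<open>k\<close>. Choosing \<open>k - 1\<close> vertices
  of the smallest class \<open>V 1\<close> and all edges that meet them gives the value on the right-hand side,
  and no \<open>k\<close> of these edges are disjoint, since each edge of a matching uses up a chosen vertex.
  For the upper bound there are two arguments.

  If \<open>s < r\<close>, compare degrees with codegrees. The number of host edges at a vertex is an elementary
  symmetric polynomial of the sizes of the other classes, largest for the vertices of the smallest
  class; call this value \<open>D\<close>. The number of host edges through two vertices is at most \<open>D / n 1\<close>
  (lemma \<open>codegree_le\<close>). Induction on \<open>k\<close> then bounds a family without a matching of size \<open>k\<close>
  (lemma \<open>card_le_if_no_matching\<close>). If some vertex \<open>v\<close> has so many edges that they cannot all meet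
  \<open>k - 1\<close> given disjoint edges avoiding \<open>v\<close>, then deleting \<open>v\<close> lowers the matching number and
  costs at most \<open>D\<close> edges. If every degree is small, all edges meet the few vertices of a maximal
  matching, and there are not enough of them. The comparison uses \<open>s\<^sup>2 * (k - 1) \<le> n 1\<close>.

  If \<open>s = r\<close>, where \<open>n 1\<close> may be too small for that argument, the edges of the host split into
  \<open>n 2 * \<dots> * n r\<close> matchings: number the vertices of each class and colour an edge by the cyclic
  differences between its first vertex and the others. An edge set without a matching of
  size \<open>k\<close> has at most \<open>k - 1\<close> edges of each colour (lemma \<open>card_le_if_no_matching_full\<close>).
\<close>

section \<open>Matchings as copies of disjoint edges\<close>

definition has_matching :: "nat \<Rightarrow> 'a set set \<Rightarrow> bool" where
  "has_matching k E \<longleftrightarrow> (\<exists>M\<subseteq>E. finite M \<and> card M = k \<and> pairwise disjnt M)"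

lemma has_matchingI_card_ge:
  assumes "M \<subseteq> E" "finite M" "pairwise disjnt M" "k \<le> card M"
  shows "has_matching k E"
proof -
  obtain N where "N \<subseteq> M" "card N = k" "finite N"
    using obtain_subset_with_card_n[OF assms(4)] by blast
  moreover have "pairwise disjnt N" using assms(3) \<open>N \<subseteq> M\<close> by (rule pairwise_subset)
  moreover have "N \<subseteq> E" using assms(1) \<open>N \<subseteq> M\<close> by blast
  ultimately show ?thesis unfolding has_matching_def by blast
qed

lemma edges_disjoint_copies_complete:
  "edges (disjoint_copies k (complete_hypergraph s s)) = (\<lambda>i. Pair i ` {..<s}) ` {..<k}"
proof -
  have "e \<subseteq> {..<s} \<and> card e = s \<longleftrightarrow> e = {..<s}" for e :: "nat set"
    by (metis card_lessThan card_subset_eq finite_lessThan subset_refl)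
  then show ?thesis
    unfolding disjoint_copies_def complete_hypergraph_def by auto
qed

lemma free_of_disjoint_copies_iff:
  assumes "uniform_hypergraph s G" "0 < s"
  shows "free_of (disjoint_copies k (complete_hypergraph s s)) G \<longleftrightarrow> \<not> has_matching k (edges G)"
proof -
  let ?F = "disjoint_copies k (complete_hypergraph s s)"
  have vF: "verts ?F = {..<k} \<times> {..<s}"
    by (simp add: disjoint_copies_def complete_hypergraph_def)
  have "has_matching k (edges G)" if sub: "subhypergraph G' G" and iso: "isomorphic ?F G'" for G'
  proof -
    obtain f where f: "bij_betw f ({..<k} \<times> {..<s}) (verts G')"
      and E: "edges G' = (\<lambda>e. f ` e) ` edges ?F"
      using iso unfolding isomorphic_def vF by blast
    let ?g = "\<lambda>i. f ` Pair i ` {..<s}"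
    have eq: "edges G' = ?g ` {..<k}"
      unfolding E edges_disjoint_copies_complete by (simp add: image_image)
    have inj: "inj_on f ({..<k} \<times> {..<s})"
      using f by (simp add: bij_betw_def)
    have disj: "disjnt (?g i) (?g j)" if "i < k" "j < k" "i \<noteq> j" for i j
      using inj_onD[OF inj] that unfolding disjnt_def by fastforce
    have "inj_on ?g {..<k}"
    proof (rule inj_onI, rule ccontr)
      fix i j assume ij: "i \<in> {..<k}" "j \<in> {..<k}" "?g i = ?g j" "i \<noteq> j"
      then have "?g i = {}"
        using disj[of i j] by (simp add: disjnt_def)
      then show False using assms(2) by auto
    qed
    then have "card (edges G') = k" by (simp add: eq card_image)
    moreover have "pairwise disjnt (edges G')"
      unfolding eq pairwise_def using disj by auto
    moreover have "finite (edges G')" by (simp add: eq)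
    ultimately show ?thesis
      using sub unfolding has_matching_def subhypergraph_def by blast
  qed
  moreover have "\<exists>G'. subhypergraph G' G \<and> isomorphic ?F G'" if "has_matching k (edges G)"
  proof -
    obtain M where M: "M \<subseteq> edges G" "finite M" "card M = k" "pairwise disjnt M"
      using \<open>has_matching k (edges G)\<close> unfolding has_matching_def by blast
    obtain g where g: "bij_betw g {..<k} M"
      using M(2,3) by (metis ex_bij_betw_nat_finite lessThan_atLeast0)
    have gM: "g i \<in> M" if "i < k" for i using g that by (auto simp: bij_betw_def)
    have "\<exists>h. bij_betw h {..<s} (g i)" if "i < k" for i
    proof -
      have "card (g i) = s"
        using assms(1) gM[OF that] M(1) by (auto simp: uniform_hypergraph_def)
      then show ?thesis
        using assms(2) by (metis card_gt_0_iff ex_bij_betw_nat_finite lessThan_atLeast0)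
    qed
    then obtain h where h: "\<And>i. i < k \<Longrightarrow> bij_betw (h i) {..<s} (g i)" by metis
    let ?f = "\<lambda>(i, x). h i x"
    have him: "h i ` {..<s} = g i" if "i < k" for i
      using h[OF that] by (simp add: bij_betw_def)
    have "inj_on ?f ({..<k} \<times> {..<s})"
    proof (rule inj_onI, clarsimp)
      fix i x j y assume *: "i < k" "j < k" "x < s" "y < s" "h i x = h j y"
      have "h i x \<in> g i \<inter> g j" using him *
        by (metis IntI imageI lessThan_iff)
      then have "\<not> disjnt (g i) (g j)" by (auto simp: disjnt_def)
      then have "g i = g j"
        using M(4) gM * unfolding pairwise_def by blast
      then have "i = j" using g * by (auto simp: bij_betw_def inj_on_def)
      then show "i = j \<and> x = y" using * h[of i] by (auto simp: bij_betw_def inj_on_def)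
    qed
    moreover have "?f ` ({..<k} \<times> {..<s}) = \<Union>M"
    proof -
      have "?f ` ({..<k} \<times> {..<s}) = (\<Union>i<k. h i ` {..<s})" by force
      also have "\<dots> = \<Union>(g ` {..<k})" using him by simp
      finally show ?thesis using g by (simp add: bij_betw_def)
    qed
    moreover have "M = (\<lambda>e. ?f ` e) ` edges ?F"
    proof -
      have "(\<lambda>e. ?f ` e) ` edges ?F = (\<lambda>i. h i ` {..<s}) ` {..<k}"
        unfolding edges_disjoint_copies_complete by (simp add: image_image)
      also have "\<dots> = g ` {..<k}" using him by simp
      finally show ?thesis using g by (simp add: bij_betw_def)
    qed
    ultimately have "isomorphic ?F \<lparr>verts = \<Union>M, edges = M\<rparr>"
      unfolding isomorphic_def vF bij_betw_def by auto
    moreover have "subhypergraph \<lparr>verts = \<Union>M, edges = M\<rparr> G"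
      using M(1) assms(1) unfolding subhypergraph_def uniform_hypergraph_def by auto
    ultimately show ?thesis by blast
  qed
  ultimately show ?thesis unfolding free_of_def by blast
qed

section \<open>Few edges without a large matching, from degrees and codegrees\<close>

lemma card_edges_meeting_le:
  assumes "finite U" "\<And>u. u \<in> U \<Longrightarrow> card {e \<in> E. u \<in> e} \<le> c" "finite E"
  shows "card {e \<in> E. \<not> disjnt e U} \<le> card U * c"
proof -
  have "{e \<in> E. \<not> disjnt e U} = (\<Union>u\<in>U. {e \<in> E. u \<in> e})" by (auto simp: disjnt_def)
  then show ?thesis
    using assms card_UN_le[OF assms(1), of "\<lambda>u. {e \<in> E. u \<in> e}"]
      sum_bounded_above[of U "\<lambda>u. card {e \<in> E. u \<in> e}" c] by simp
qed

lemma card_Union_uniform_le: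
  assumes "\<And>e. e \<in> M \<Longrightarrow> card e = s" "finite M"
  shows "card (\<Union>M) \<le> card M * s"
  using card_Union_le_sum_card[of M] assms by simp

lemma ex_maximal_matching:
  assumes "finite E" "{} \<notin> E" "\<not> has_matching (Suc k) E"
  obtains M where "M \<subseteq> E" "card M \<le> k" "\<And>e. e \<in> E \<Longrightarrow> \<not> disjnt e (\<Union>M)"
proof -
  let ?P = "\<lambda>M. M \<subseteq> E \<and> pairwise disjnt M"
  have "finite {M. ?P M}" using assms(1) by simp
  moreover have "{} \<in> {M. ?P M}" by simp
  ultimately obtain M where M: "?P M" and max: "\<And>N. ?P N \<Longrightarrow> M \<subseteq> N \<Longrightarrow> N = M"
    using finite_has_maximal[of "{M. ?P M}"] by (smt (verit) empty_iff mem_Collect_eq)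
  have "card M \<le> k"
    using has_matchingI_card_ge[of M E "Suc k"] M assms(1,3) finite_subset[of M E] by fastforce
  moreover have "\<not> disjnt e (\<Union>M)" if "e \<in> E" for e
  proof
    assume d: "disjnt e (\<Union>M)"
    then have "?P (insert e M)"
      using M that by (auto simp: pairwise_insert disjnt_def)
    then have "e \<in> M" using max by blast
    then have "e = {}" using d by (auto simp: disjnt_def)
    then show False using that assms(2) by simp
  qed
  ultimately show ?thesis using that M by blast
qed

text \<open>
  Disjoint edges number at most \<open>k\<close>, so they cover at most \<open>k * s\<close> vertices and, if they avoid a
  vertex \<open>v\<close>, meet at most \<open>k * s * C\<close> edges at \<open>v\<close>. A vertex of larger degree has an edge that
  extends any matching avoiding it, so it can be removed at a cost of \<open>D\<close>. If there is no such
  vertex, all edges lie at the at most \<open>k * s\<close> vertices of a maximal matching, so there are at most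
  \<open>k * (s\<^sup>2 * k * C)\<close> of them.
\<close>

lemma card_le_if_no_matching:
  fixes E :: "'a set set"
  assumes "finite E" "\<And>e. e \<in> E \<Longrightarrow> card e = s" "0 < s"
    and "\<And>v. card {e \<in> E. v \<in> e} \<le> D"
    and "\<And>u v. u \<noteq> v \<Longrightarrow> card {e \<in> E. u \<in> e \<and> v \<in> e} \<le> C"
    and "s\<^sup>2 * k * C \<le> D"
    and "\<not> has_matching (Suc k) E"
  shows "card E \<le> k * D"
  using assms
proof (induction k arbitrary: E)
  case 0
  have "E = {}"
  proof (rule ccontr)
    assume "E \<noteq> {}"
    then obtain e where "e \<in> E" by blast
    then have "has_matching (Suc 0) E"
      by (intro has_matchingI_card_ge[of "{e}"]) auto
    then show False using 0 by simp
  qed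
  then show ?case by simp
next
  case (Suc k)
  note prems = Suc.prems
  have fin: "finite e" if "e \<in> E" for e
    using prems(2)[OF that] prems(3) card_gt_0_iff by fastforce
  define t where "t = Suc k * s * C"
  show ?case
  proof (cases "\<exists>v. card {e \<in> E. v \<in> e} > t")
    case True
    then obtain v where v: "card {e \<in> E. v \<in> e} > t" by blast
    let ?E = "{e \<in> E. v \<notin> e}"
    have "\<not> has_matching (Suc k) ?E"
    proof
      assume "has_matching (Suc k) ?E"
      then obtain M where M: "M \<subseteq> ?E" "finite M" "card M = Suc k" "pairwise disjnt M"
        unfolding has_matching_def by blast
      have cU: "card (\<Union>M) \<le> Suc k * s"
        using card_Union_uniform_le[of M s] prems(2) M by auto
      have fU: "finite (\<Union>M)" using M fin by auto
      have "card {e \<in> {e \<in> E. v \<in> e}. \<not> disjnt e (\<Union>M)} \<le> card (\<Union>M) * C"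
      proof (rule card_edges_meeting_le[OF fU])
        fix u assume "u \<in> \<Union>M"
        then have "v \<noteq> u" using M by auto
        then show "card {e \<in> {e \<in> E. v \<in> e}. u \<in> e} \<le> C"
          using prems(5)[of v u] by (simp add: conj_assoc)
      qed (use prems(1) in simp)
      also have "\<dots> \<le> t" unfolding t_def using cU by (rule mult_right_mono) simp
      also note v
      finally have "{e \<in> {e \<in> E. v \<in> e}. \<not> disjnt e (\<Union>M)} \<noteq> {e \<in> E. v \<in> e}" by force
      then obtain e where e: "e \<in> E" "v \<in> e" "disjnt e (\<Union>M)" by blast
      have "e \<notin> M" using M(1) e(2) by blast
      moreover have "pairwise disjnt (insert e M)"
        using M(4) e(3) by (auto simp: pairwise_insert disjnt_def)
      ultimately have "has_matching (Suc (Suc k)) E"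
        using M e by (intro has_matchingI_card_ge[of "insert e M"]) auto
      then show False using prems(7) by blast
    qed
    moreover have "card {e \<in> ?E. w \<in> e} \<le> D" for w
      by (rule order_trans[OF card_mono prems(4)[of w]]) (use prems(1) in auto)
    moreover have "card {e \<in> ?E. u \<in> e \<and> w \<in> e} \<le> C" if "u \<noteq> w" for u w
      by (rule order_trans[OF card_mono prems(5)[OF that]]) (use prems(1) in auto)
    moreover have "s\<^sup>2 * k * C \<le> D"
      by (rule order_trans[OF _ prems(6)]) simp
    ultimately have "card ?E \<le> k * D"
      using prems(1-3) by (intro Suc.IH) auto
    moreover have "card E = card ?E + card {e \<in> E. v \<in> e}"
      using prems(1) by (subst card_Un_disjoint[symmetric]) (auto intro!: arg_cong[of _ _ card])
    ultimately show ?thesis using prems(4)[of v] by simp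
  next
    case False
    have "{} \<notin> E" using prems(2,3) by fastforce
    then obtain M where M: "M \<subseteq> E" "card M \<le> Suc k" "\<And>e. e \<in> E \<Longrightarrow> \<not> disjnt e (\<Union>M)"
      using ex_maximal_matching prems(1,7) by metis
    have fM: "finite M" using M(1) prems(1) finite_subset by blast
    have "card (\<Union>M) \<le> card M * s"
      using card_Union_uniform_le[of M s] prems(2) M(1) fM by auto
    then have cU: "card (\<Union>M) \<le> Suc k * s" using mult_right_mono[OF M(2), of s] by linarith
    have "finite (\<Union>M)" using M(1) fM fin by auto
    then have le: "card {e \<in> E. \<not> disjnt e (\<Union>M)} \<le> card (\<Union>M) * t"
      using False prems(1) by (intro card_edges_meeting_le) (auto simp: not_less)
    have "{e \<in> E. \<not> disjnt e (\<Union>M)} = E" using M(3) by blast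
    then have "card E \<le> card (\<Union>M) * t" using le by (simp only:)
    also have "\<dots> \<le> (Suc k * s) * t" using cU by (rule mult_right_mono) simp
    also have "\<dots> = Suc k * (s\<^sup>2 * Suc k * C)"
      unfolding t_def by (simp add: power2_eq_square algebra_simps)
    also have "\<dots> \<le> Suc k * D" using prems(6) by (rule mult_left_mono) simp
    finally show ?thesis .
  qed
qed

section \<open>Counting partial transversals\<close>

definition partial_transversals :: "('i \<Rightarrow> 'a set) \<Rightarrow> nat \<Rightarrow> 'i set \<Rightarrow> 'a set set" where
  "partial_transversals V m I =
     {e. e \<subseteq> (\<Union>i\<in>I. V i) \<and> card e = m \<and> (\<forall>i\<in>I. card (e \<inter> V i) \<le> 1)}"

definition elem_sym :: "('i \<Rightarrow> nat) \<Rightarrow> nat \<Rightarrow> 'i set \<Rightarrow> nat" where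
  "elem_sym n m I = (\<Sum>A | A \<subseteq> I \<and> card A = m. \<Prod>i\<in>A. n i)"

lemma elem_sym_0: "finite I \<Longrightarrow> elem_sym n 0 I = 1"
proof -
  assume "finite I"
  then have "{A. A \<subseteq> I \<and> card A = 0} = {{}}" by (auto dest: finite_subset)
  then show ?thesis by (simp add: elem_sym_def)
qed

lemma elem_sym_Suc_insert:
  assumes "finite I" "i \<notin> I"
  shows "elem_sym n (Suc m) (insert i I) = elem_sym n (Suc m) I + n i * elem_sym n m I"
proof -
  let ?A = "{A. A \<subseteq> I \<and> card A = Suc m}" and ?B = "{A. A \<subseteq> I \<and> card A = m}"
  have "{A. A \<subseteq> insert i I \<and> card A = Suc m} = ?A \<union> insert i ` ?B" (is "?L = _")
  proof (intro equalityI subsetI)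
    fix A assume A: "A \<in> ?L"
    then have "finite A" using assms(1) finite_subset by auto
    show "A \<in> ?A \<union> insert i ` ?B"
    proof (cases "i \<in> A")
      case True
      then have "A = insert i (A - {i})" "A - {i} \<in> ?B" using A \<open>finite A\<close> by auto
      then show ?thesis by blast
    qed (use A in auto)
  next
    fix A assume "A \<in> ?A \<union> insert i ` ?B"
    then show "A \<in> ?L"
      using assms by (auto simp: card_insert_if finite_subset)
  qed
  moreover have "inj_on (insert i) ?B"
    using assms(2) by (auto intro!: inj_onI dest: insert_ident[THEN iffD1, rotated 2])
  moreover have "prod n (insert i A) = n i * prod n A" if "A \<in> ?B" for A
    using that assms finite_subset by (subst prod.insert) auto
  ultimately have "sum (prod n) (insert i ` ?B) = n i * elem_sym n m I"
    unfolding elem_sym_def by (simp add: sum.reindex sum_distrib_left)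
  moreover have "?A \<inter> insert i ` ?B = {}" using assms(2) by auto
  ultimately show ?thesis
    unfolding elem_sym_def \<open>?L = _\<close> using assms(1) by (simp add: sum.union_disjoint)
qed

lemma elem_sym_full:
  assumes "finite I" shows "elem_sym n (card I) I = prod n I"
proof -
  have "{A. A \<subseteq> I \<and> card A = card I} = {I}"
    using card_subset_eq[OF assms] by auto
  then show ?thesis by (simp add: elem_sym_def)
qed

text \<open>The two polynomials share the terms
  that avoid both \<open>i\<close> and \<open>j\<close>, and the other terms differ only in the factor \<open>n j\<close> or \<open>n i\<close>.\<close>

lemma elem_sym_remove_le:
  assumes "finite I" "i \<in> I" "j \<in> I" "n j \<le> n i"
  shows "elem_sym n (Suc m) (I - {i}) \<le> elem_sym n (Suc m) (I - {j})"
proof (cases "i = j")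
  case False
  let ?J = "I - {i, j}"
  have eqs: "I - {i} = insert j ?J" "I - {j} = insert i ?J" using False assms by auto
  have J: "finite ?J" "i \<notin> ?J" "j \<notin> ?J" using assms(1) by auto
  show ?thesis
    unfolding eqs elem_sym_Suc_insert[OF J(1,2)] elem_sym_Suc_insert[OF J(1,3)]
    using assms(4) by simp
qed simp

lemma elem_sym_remove_mult_le:
  assumes "finite I" "j \<in> I"
  shows "n j * elem_sym n m (I - {j}) \<le> elem_sym n (Suc m) I"
  using elem_sym_Suc_insert[of "I - {j}" j n m] assms by (simp add: insert_absorb)

locale finite_classes =
  fixes V :: "'i \<Rightarrow> 'a set" and I :: "'i set"
  assumes finI: "finite I"
    and disj: "disjoint_family_on V I"
    and finV: "\<And>i. i \<in> I \<Longrightarrow> finite (V i)"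
begin

lemma finite_partial_transversals: "finite (partial_transversals V m I)"
proof (rule finite_subset)
  show "partial_transversals V m I \<subseteq> Pow (\<Union>i\<in>I. V i)"
    by (auto simp: partial_transversals_def)
  show "finite (Pow (\<Union>i\<in>I. V i))" using finI finV by simp
qed

lemma finite_mem_partial_transversals: "e \<in> partial_transversals V m I \<Longrightarrow> finite e"
  unfolding partial_transversals_def
  by (metis (mono_tags, lifting) CollectD finI finV finite_UN_I finite_subset)

lemma class_unique: "i \<in> I \<Longrightarrow> j \<in> I \<Longrightarrow> v \<in> V i \<Longrightarrow> v \<in> V j \<Longrightarrow> i = j"
  using disj by (auto simp: disjoint_family_on_def)

lemma partial_transversal_unique:
  assumes "e \<in> partial_transversals V m I" "i \<in> I" "u \<in> e" "v \<in> e" "u \<in> V i" "v \<in> V i"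
  shows "u = v"
proof -
  have "card (e \<inter> V i) \<le> 1" using assms by (auto simp: partial_transversals_def)
  moreover have "finite (e \<inter> V i)" using finV assms(2) by auto
  ultimately show ?thesis using assms by (auto simp: card_le_Suc0_iff_eq)
qed

text \<open>All degree and codegree counts come from this link: deleting a vertex from a partial transversal
  leaves one of the other classes, and every such one arises.\<close>

lemma partial_transversals_at_eq:
  assumes "i \<in> I" "v \<in> V i"
  shows "{e \<in> partial_transversals V (Suc m) I. v \<in> e}
           = insert v ` partial_transversals V m (I - {i})" (is "?L = ?R")
proof (intro equalityI subsetI)
  fix e assume e: "e \<in> ?L"
  have fin: "finite e" using e finite_mem_partial_transversals by auto
  have "e - {v} \<subseteq> (\<Union>j\<in>I - {i}. V j)"
  proof
    fix u assume u: "u \<in> e - {v}"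
    then obtain j where "j \<in> I" "u \<in> V j" using e by (auto simp: partial_transversals_def)
    moreover have "j \<noteq> i"
      using partial_transversal_unique[of e "Suc m" i u v] e u assms calculation by auto
    ultimately show "u \<in> (\<Union>j\<in>I - {i}. V j)" by blast
  qed
  moreover have "card ((e - {v}) \<inter> V j) \<le> 1" if "j \<in> I" for j
  proof -
    have "card ((e - {v}) \<inter> V j) \<le> card (e \<inter> V j)"
      using fin by (intro card_mono) auto
    also have "\<dots> \<le> 1" using e that by (auto simp: partial_transversals_def)
    finally show ?thesis .
  qed
  ultimately have "e - {v} \<in> partial_transversals V m (I - {i})"
    using e fin by (auto simp: partial_transversals_def)
  moreover have "e = insert v (e - {v})" using e by auto
  ultimately show "e \<in> ?R" by blast
next
  fix e assume "e \<in> ?R"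
  then obtain f where f: "f \<in> partial_transversals V m (I - {i})" "e = insert v f" by blast
  have fsub: "f \<subseteq> (\<Union>j\<in>I - {i}. V j)" using f by (auto simp: partial_transversals_def)
  have "f \<inter> V i = {}" using fsub class_unique assms by blast
  then have "e \<inter> V i = {v}" "v \<notin> f" using f assms by auto
  moreover have "e \<inter> V j = f \<inter> V j" if "j \<in> I - {i}" for j
    using class_unique[of i j v] that f assms by auto
  moreover have "finite f"
    using fsub by (rule finite_subset) (use finI finV in auto)
  moreover have "card (f \<inter> V j) \<le> 1" if "j \<in> I - {i}" for j
    using f that by (auto simp: partial_transversals_def)
  ultimately have "card e = Suc m" "card (e \<inter> V j) \<le> 1" if "j \<in> I" for j
    using f that by (cases "j = i"; auto simp: partial_transversals_def)+
  moreover have "e \<subseteq> (\<Union>j\<in>I. V j)" using f fsub assms by auto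
  ultimately show "e \<in> ?L" using f assms(1) by (auto simp: partial_transversals_def)
qed

lemma card_partial_transversals_at:
  assumes "i \<in> I" "v \<in> V i"
  shows "card {e \<in> partial_transversals V (Suc m) I. v \<in> e}
           = card (partial_transversals V m (I - {i}))"
proof -
  have "v \<notin> e" if "e \<in> partial_transversals V m (I - {i})" for e
    using class_unique assms that by (fastforce simp: partial_transversals_def)
  then have "inj_on (insert v) (partial_transversals V m (I - {i}))"
    by (intro inj_onI) (metis insert_ident)
  then show ?thesis by (simp add: partial_transversals_at_eq[OF assms] card_image)
qed

text \<open>A partial transversal has at most one vertex in the class, so nothing is counted twice.\<close>

lemma card_partial_transversals_meeting:
  assumes "i \<in> I" "S \<subseteq> V i"
  shows "card {e \<in> partial_transversals V (Suc m) I. \<not> disjnt e S}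
           = card S * card (partial_transversals V m (I - {i}))"
proof -
  let ?at = "\<lambda>v. {e \<in> partial_transversals V (Suc m) I. v \<in> e}"
  have "{e \<in> partial_transversals V (Suc m) I. \<not> disjnt e S} = (\<Union>v\<in>S. ?at v)"
    by (auto simp: disjnt_def)
  moreover have "card (\<Union>v\<in>S. ?at v) = (\<Sum>v\<in>S. card (?at v))"
  proof (rule card_UN_disjoint)
    show "finite S" using assms finV finite_subset by blast
    show "\<forall>u\<in>S. finite (?at u)" using finite_partial_transversals by simp
    show "\<forall>u\<in>S. \<forall>v\<in>S. u \<noteq> v \<longrightarrow> ?at u \<inter> ?at v = {}"
      using partial_transversal_unique[of _ "Suc m" i] assms by blast
  qed
  moreover have "card (?at v) = card (partial_transversals V m (I - {i}))" if "v \<in> S" for v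
    using card_partial_transversals_at[of i v m] assms that by blast
  ultimately show ?thesis by simp
qed

lemma finite_classes_Diff: "finite_classes V (I - J)"
  using finI disj finV by unfold_locales (auto simp: disjoint_family_on_def)

end

text \<open>The partial transversals that avoid or meet a new class satisfy the recursion
  \<open>elem_sym_Suc_insert\<close>.\<close>

lemma card_partial_transversals:
  assumes "finite_classes V I"
  shows "card (partial_transversals V m I) = elem_sym (\<lambda>i. card (V i)) m I"
proof -
  have "finite I" using assms by (simp add: finite_classes_def)
  then show ?thesis using assms
  proof (induction I arbitrary: m rule: finite_induct)
    case empty
    have "partial_transversals V m {} = (if m = 0 then {{}} else {})"
      by (auto simp: partial_transversals_def)
    moreover have "{A. A \<subseteq> ({} :: 'a set) \<and> card A = m} = (if m = 0 then {{}} else {})"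
      by auto
    ultimately show ?case by (simp add: elem_sym_def)
  next
    case (insert i I)
    interpret finite_classes V "insert i I" by fact
    have diff: "insert i I - {i} = I" using insert.hyps by simp
    have cl: "finite_classes V I" using finite_classes_Diff[of "{i}"] diff by simp
    show ?case
    proof (cases m)
      case 0
      have "e = {}" if "e \<in> partial_transversals V 0 (insert i I)" for e
        using finite_mem_partial_transversals[OF that] that by (simp add: partial_transversals_def)
      moreover have "{} \<in> partial_transversals V 0 (insert i I)"
        by (simp add: partial_transversals_def)
      ultimately have "partial_transversals V 0 (insert i I) = {{}}" by blast
      then show ?thesis using 0 insert.hyps by (simp add: elem_sym_0)
    next
      case (Suc l)
      let ?T = "partial_transversals V m (insert i I)"
      have "{e \<in> ?T. disjnt e (V i)} = partial_transversals V m I"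
      proof (intro equalityI subsetI)
        fix e assume "e \<in> partial_transversals V m I"
        moreover from this have "e \<inter> V i = {}"
          using class_unique[of i] insert.hyps by (fastforce simp: partial_transversals_def)
        ultimately show "e \<in> {e \<in> ?T. disjnt e (V i)}"
          by (auto simp: partial_transversals_def disjnt_def)
      qed (auto simp: partial_transversals_def disjnt_def)
      moreover have "card {e \<in> ?T. \<not> disjnt e (V i)}
          = card (V i) * card (partial_transversals V l I)"
        using card_partial_transversals_meeting[of i "V i" l] diff Suc by simp
      moreover have "card ?T = card {e \<in> ?T. disjnt e (V i)} + card {e \<in> ?T. \<not> disjnt e (V i)}"
        using finite_partial_transversals[of m]
        by (subst card_Un_disjoint[symmetric]) (auto intro!: arg_cong[of _ _ card])
      ultimately show ?thesis
        using insert.IH[OF cl] insert.hyps Suc by (simp add: elem_sym_Suc_insert)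
    qed
  qed
qed

section \<open>Upper bounds on families of partial transversals without a large matching\<close>

context finite_classes
begin

lemma degree_le:
  assumes "j \<in> I" "\<And>i. i \<in> I \<Longrightarrow> card (V j) \<le> card (V i)"
  shows "card {e \<in> partial_transversals V (Suc (Suc m)) I. v \<in> e}
           \<le> elem_sym (\<lambda>i. card (V i)) (Suc m) (I - {j})"
proof (cases "\<exists>i\<in>I. v \<in> V i")
  case True
  then obtain i where i: "i \<in> I" "v \<in> V i" by blast
  \<comment> \<open>The degree is the polynomial without the class \<open>i\<close>, and the class \<open>j\<close> is smallest.\<close>
  then show ?thesis
    using elem_sym_remove_le[OF finI i(1) assms(1), of "\<lambda>i. card (V i)"] assms
    by (simp add: card_partial_transversals_at card_partial_transversals[OF finite_classes_Diff])
next
  case False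
  then have "{e \<in> partial_transversals V (Suc (Suc m)) I. v \<in> e} = {}"
    by (auto simp: partial_transversals_def)
  then show ?thesis by (simp only: card.empty le0)
qed

text \<open>
  If \<open>u\<close> and \<open>v\<close> lie in one class, no edge contains both. Otherwise all vertices of the class of \<open>u\<close>
  have the same codegree with \<open>v\<close>, and together these codegrees count distinct edges at \<open>v\<close>; so
  the size of that class times the codegree is at most the degree of \<open>v\<close>.
\<close>

lemma codegree_le:
  assumes "j \<in> I" "\<And>i. i \<in> I \<Longrightarrow> card (V j) \<le> card (V i)" "u \<noteq> v"
  shows "card (V j) * card {e \<in> partial_transversals V (Suc (Suc m)) I. u \<in> e \<and> v \<in> e}
           \<le> elem_sym (\<lambda>i. card (V i)) (Suc m) (I - {j})"
proof (cases "\<exists>a\<in>I. \<exists>b\<in>I. a \<noteq> b \<and> u \<in> V a \<and> v \<in> V b")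
  case True
  then obtain a b where ab: "a \<in> I" "b \<in> I" "a \<noteq> b" "u \<in> V a" "v \<in> V b" by blast
  interpret B: finite_classes V "I - {b}" by (rule finite_classes_Diff)
  let ?T = "partial_transversals V (Suc m) (I - {b})"
  have "{e \<in> partial_transversals V (Suc (Suc m)) I. u \<in> e \<and> v \<in> e}
      = {e \<in> {e \<in> partial_transversals V (Suc (Suc m)) I. v \<in> e}. u \<in> e}" by auto
  also have "\<dots> = {e \<in> insert v ` ?T. u \<in> e}"
    by (simp only: partial_transversals_at_eq[OF ab(2,5)])
  also have "\<dots> = insert v ` {e \<in> ?T. u \<in> e}" using assms(3) by auto
  finally have "card {e \<in> partial_transversals V (Suc (Suc m)) I. u \<in> e \<and> v \<in> e}
      \<le> card {e \<in> ?T. u \<in> e}"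
    using B.finite_partial_transversals by (simp add: card_image_le)
  also have "\<dots> = elem_sym (\<lambda>i. card (V i)) m (I - {b} - {a})"
    using B.card_partial_transversals_at[of a u m] ab
      card_partial_transversals[OF B.finite_classes_Diff] by simp
  finally have "card (V j) * card {e \<in> partial_transversals V (Suc (Suc m)) I. u \<in> e \<and> v \<in> e}
      \<le> card (V a) * elem_sym (\<lambda>i. card (V i)) m (I - {b} - {a})"
    using assms(2)[OF ab(1)] by (simp add: mult_mono)
  also have "\<dots> \<le> elem_sym (\<lambda>i. card (V i)) (Suc m) (I - {b})"
    using ab finI by (intro elem_sym_remove_mult_le[of "I - {b}" a "\<lambda>i. card (V i)"]) auto
  also have "\<dots> \<le> elem_sym (\<lambda>i. card (V i)) (Suc m) (I - {j})"
    using assms(2)[OF ab(2)] by (intro elem_sym_remove_le[OF finI ab(2) assms(1)])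
  finally show ?thesis .
next
  case False
  have "{e \<in> partial_transversals V (Suc (Suc m)) I. u \<in> e \<and> v \<in> e} = {}"
  proof (rule ccontr)
    assume "\<not> ?thesis"
    then obtain e where e: "e \<in> partial_transversals V (Suc (Suc m)) I" "u \<in> e" "v \<in> e" by blast
    then have "u \<in> (\<Union>i\<in>I. V i)" "v \<in> (\<Union>i\<in>I. V i)"
      by (auto simp: partial_transversals_def)
    then obtain a b where ab: "a \<in> I" "u \<in> V a" "b \<in> I" "v \<in> V b" by blast
    have "a = b"
    proof (rule ccontr)
      assume "a \<noteq> b"
      then have "a \<noteq> b \<and> u \<in> V a \<and> v \<in> V b" using ab by simp
      then show False using False ab(1,3) by meson
    qed
    then show False
      using partial_transversal_unique[OF e(1) ab(1) e(2,3) ab(2)] ab(4) assms(3) by simp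
  qed
  then show ?thesis by (simp only: card.empty mult_0_right le0)
qed

lemma card_le_if_no_matching_large_classes:
  assumes "j \<in> I" "\<And>i. i \<in> I \<Longrightarrow> card (V j) \<le> card (V i)" "2 \<le> s"
    and "s\<^sup>2 * k \<le> card (V j)"
    and "E \<subseteq> partial_transversals V s I" "\<not> has_matching (Suc k) E"
  shows "card E \<le> k * elem_sym (\<lambda>i. card (V i)) (s - 1) (I - {j})"
  \<comment> \<open>The codegree bound used is a quotient by \<open>card (V j)\<close>, so an empty class is separate.\<close>
proof (cases "card (V j) = 0")
  case True
  then have "k = 0" using assms(3,4) by simp
  moreover have "E = {}" if "k = 0"
  proof (rule ccontr)
    assume "E \<noteq> {}"
    then obtain e where "e \<in> E" by blast
    then have "has_matching (Suc 0) E" by (intro has_matchingI_card_ge[of "{e}"]) auto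
    then show False using assms(6) that by simp
  qed
  ultimately show ?thesis by simp
next
  case False
  obtain m where s: "s = Suc (Suc m)" using assms(3) by (metis add_2_eq_Suc le_Suc_ex)
  let ?D = "elem_sym (\<lambda>i. card (V i)) (Suc m) (I - {j})"
  let ?T = "partial_transversals V s I"
  have finT: "finite ?T" by (rule finite_partial_transversals)
  show ?thesis
    unfolding s diff_Suc_1
  proof (rule card_le_if_no_matching[where s = s and C = "?D div card (V j)"])
    show "finite E" using finT assms(5) finite_subset by blast
    show "card e = s" if "e \<in> E" for e
      using that assms(5) by (auto simp: partial_transversals_def)
    show "0 < s" using assms(3) by simp
    show "card {e \<in> E. v \<in> e} \<le> ?D" for v
    proof -
      have "card {e \<in> E. v \<in> e} \<le> card {e \<in> ?T. v \<in> e}"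
        using finT assms(5) by (auto intro!: card_mono)
      also have "\<dots> \<le> ?D"
        unfolding s by (rule degree_le) (use assms(1,2) in auto)
      finally show ?thesis .
    qed
    show "card {e \<in> E. u \<in> e \<and> v \<in> e} \<le> ?D div card (V j)" if "u \<noteq> v" for u v
    proof -
      have "card {e \<in> E. u \<in> e \<and> v \<in> e} \<le> card {e \<in> ?T. u \<in> e \<and> v \<in> e}"
        using finT assms(5) by (auto intro!: card_mono)
      also have "\<dots> \<le> ?D div card (V j)"
        using codegree_le[OF assms(1,2) that, of m] False unfolding s[symmetric]
        by (simp add: less_eq_div_iff_mult_less_eq mult.commute)
      finally show ?thesis .
    qed
    have "s\<^sup>2 * k * (?D div card (V j)) \<le> card (V j) * (?D div card (V j))"
      using assms(4) by (rule mult_right_mono) simp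
    also have "\<dots> \<le> ?D" by simp
    finally show "s\<^sup>2 * k * (?D div card (V j)) \<le> ?D" .
    show "\<not> has_matching (Suc k) E" by fact
  qed
qed

end

lemma card_le_if_colour_classes_le:
  assumes "finite E" "finite C" "c ` E \<subseteq> C" "\<And>x. x \<in> C \<Longrightarrow> card {e \<in> E. c e = x} \<le> k"
  shows "card E \<le> k * card C"
proof -
  have "card E = (\<Sum>x\<in>C. card {e \<in> E. c e = x})"
    using sum.group[OF assms(1-3), of "\<lambda>_. 1::nat"] by simp
  also have "\<dots> \<le> k * card C" using sum_bounded_above[of C _ k] assms(4) by (simp add: mult.commute)
  finally show ?thesis .
qed

text \<open>Edges of one colour that share a vertex agree in the class \<open>j\<close>, because the numbers there
  are too small to be changed by a reduction modulo the size of another class; then the colour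
  determines all their other vertices.\<close>

lemma (in finite_classes) card_le_if_no_matching_full:
  assumes "j \<in> I" "\<And>i. i \<in> I \<Longrightarrow> card (V j) \<le> card (V i)"
    and "E \<subseteq> partial_transversals V (card I) I" "\<not> has_matching (Suc k) E"
  shows "card E \<le> k * (\<Prod>i\<in>I - {j}. card (V i))"
proof -
  \<comment> \<open>\<open>p e i\<close> is the vertex of \<open>e\<close> in the class \<open>i\<close>; it exists because \<open>e\<close> has as many vertices
    as there are classes.\<close>
  define p where "p e i = (SOME v. v \<in> e \<and> v \<in> V i)" for e i
  obtain q where q: "\<And>i. i \<in> I \<Longrightarrow> bij_betw (q i) (V i) {..<card (V i)}"
  proof -
    have "\<forall>i\<in>I. \<exists>h. bij_betw h (V i) {..<card (V i)}"
      using ex_bij_betw_finite_nat[OF finV] by (simp add: lessThan_atLeast0)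
    from bchoice[OF this] show ?thesis using that by blast
  qed
  let ?T = "partial_transversals V (card I) I"
  have ex: "\<exists>v. v \<in> e \<and> v \<in> V i" if e: "e \<in> ?T" and i: "i \<in> I" for e i
  proof (rule ccontr)
    assume no: "\<not> ?thesis"
    have "e \<subseteq> (\<Union>l\<in>I - {i}. V l)"
    proof
      fix v assume "v \<in> e"
      then obtain l where "l \<in> I" "v \<in> V l" using e by (auto simp: partial_transversals_def)
      moreover have "l \<noteq> i" using no \<open>v \<in> e\<close> \<open>v \<in> V l\<close> by auto
      ultimately show "v \<in> (\<Union>l\<in>I - {i}. V l)" by auto
    qed
    then have "e = (\<Union>l\<in>I - {i}. e \<inter> V l)" by blast
    then have "card e \<le> (\<Sum>l\<in>I - {i}. card (e \<inter> V l))"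
      using card_UN_le[of "I - {i}" "\<lambda>l. e \<inter> V l"] finI by auto
    also have "\<dots> \<le> card (I - {i})"
      using sum_bounded_above[of "I - {i}" "\<lambda>l. card (e \<inter> V l)" 1] e
      by (auto simp: partial_transversals_def)
    also have "\<dots> < card I" using finI i by (rule card_Diff1_less)
    finally show False using e by (simp add: partial_transversals_def)
  qed
  have p: "p e i \<in> e \<and> p e i \<in> V i" if "e \<in> ?T" "i \<in> I" for e i
    unfolding p_def using ex[OF that] by (rule someI_ex)
  have p_eq: "p e i = v" if "e \<in> ?T" "i \<in> I" "v \<in> e" "v \<in> V i" for e i v
    using p[OF that(1,2)] partial_transversal_unique[OF that(1,2) _ that(3) _ that(4)] by simp
  have e_eq: "e = p e ` I" if e: "e \<in> ?T" for e
  proof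
    show "e \<subseteq> p e ` I"
    proof
      fix v assume "v \<in> e"
      then obtain i where "i \<in> I" "v \<in> V i" using e by (auto simp: partial_transversals_def)
      then show "v \<in> p e ` I" using p_eq[OF e _ \<open>v \<in> e\<close>] by blast
    qed
    show "p e ` I \<subseteq> e" using p[OF e] by blast
  qed
  define d where "d e i = (int (q i (p e i)) - int (q j (p e j))) mod int (card (V i))" for e i
  define c where "c e = restrict (d e) (I - {j})" for e
  let ?C = "\<Pi>\<^sub>E i\<in>I - {j}. {0..<int (card (V i))}"
  have qlt: "q i v < card (V i)" if "i \<in> I" "v \<in> V i" for i v
    using q[OF that(1)] that(2) by (auto simp: bij_betw_def)
  have q_inj: "u = v" if "i \<in> I" "u \<in> V i" "v \<in> V i" "q i u = q i v" for i u v
    using q[OF that(1)] that by (auto simp: bij_betw_def inj_on_def)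
  have c_in: "c e \<in> ?C" if "e \<in> ?T" for e
  proof -
    have "card (V i) > 0" if "i \<in> I" for i
      using qlt[OF that] p[OF \<open>e \<in> ?T\<close> that] by fastforce
    then show ?thesis unfolding c_def d_def by auto
  qed
  have d_eq: "d e i = d f i" if "e \<in> ?T" "f \<in> ?T" "c e = c f" "i \<in> I" for e f i
  proof (cases "i = j")
    case False
    then show ?thesis
      using fun_cong[OF that(3), of i] that(4) by (simp add: c_def)
  qed (simp add: d_def)
  have same: "e = f" if e: "e \<in> ?T" and f: "f \<in> ?T" and c: "c e = c f" and nd: "\<not> disjnt e f" for e f
  proof -
    obtain v where v: "v \<in> e" "v \<in> f" using nd by (auto simp: disjnt_def)
    then obtain i where i: "i \<in> I" "v \<in> V i" using e by (auto simp: partial_transversals_def)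
    have pv: "p e i = v" "p f i = v" using p_eq e f i v by auto
    have "int (q j (p e j)) mod int (card (V i)) = int (q j (p f j)) mod int (card (V i))"
    proof -
      have "(int (q i v) - int (q j (p e j))) mod int (card (V i))
          = (int (q i v) - int (q j (p f j))) mod int (card (V i))"
        using d_eq[OF e f c i(1)] pv by (simp add: d_def)
      then show ?thesis by (simp add: mod_eq_dvd_iff dvd_diff_commute)
    qed
    moreover have "q j (p g j) < card (V i)" if "g \<in> ?T" for g
      using qlt[OF assms(1), of "p g j"] p[OF that assms(1)] assms(2)[OF i(1)] by simp
    ultimately have qj: "q j (p e j) = q j (p f j)" using e f by simp
    have "p e l = p f l" if l: "l \<in> I" for l
    proof -
      have "int (q l (p e l)) mod int (card (V l)) = int (q l (p f l)) mod int (card (V l))"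
        using d_eq[OF e f c l] qj by (simp add: d_def mod_eq_dvd_iff)
      then have "q l (p e l) = q l (p f l)"
        using qlt[OF l, of "p e l"] qlt[OF l, of "p f l"] p[OF e l] p[OF f l] by simp
      then show ?thesis using q_inj[OF l] p[OF e l] p[OF f l] by simp
    qed
    then have "p e ` I = p f ` I" by (rule image_cong[OF refl])
    then show ?thesis using e_eq[OF e] e_eq[OF f] by simp
  qed
  have finE: "finite E" using assms(3) finite_partial_transversals finite_subset by blast
  have "card E \<le> k * card ?C"
  proof (rule card_le_if_colour_classes_le[OF finE])
    show "finite ?C" using finI by (intro finite_PiE) auto
    show "c ` E \<subseteq> ?C" using c_in assms(3) by blast
    fix x
    have "pairwise disjnt {e \<in> E. c e = x}"
      unfolding pairwise_def using same assms(3) by blast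
    moreover have "{e \<in> E. c e = x} \<subseteq> E" "finite {e \<in> E. c e = x}" using finE by auto
    ultimately have "\<not> Suc k \<le> card {e \<in> E. c e = x}"
      using has_matchingI_card_ge assms(4) by blast
    then show "card {e \<in> E. c e = x} \<le> k" by simp
  qed
  also have "card ?C = (\<Prod>i\<in>I - {j}. card (V i))"
    using finI by (subst card_PiE) auto
  finally show ?thesis .
qed

section \<open>The Turan number\<close>

theorem theorem1p3:
  fixes s r k :: nat and n :: "nat \<Rightarrow> nat" and V :: "nat \<Rightarrow> 'a set"
  assumes "2 \<le> s" and "s \<le> r" and "1 \<le> k"
    and "mono_on {1..r} n"
    and "s + 2 \<le> r \<Longrightarrow> n 1 \<ge> s ^ 3 * k + s * r"
    and "s + 1 = r \<Longrightarrow> n 1 \<ge> s ^ 3 * k ^ 2 + s * r"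
    and "s = r \<Longrightarrow> n 1 \<ge> k"
    and "disjoint_family_on V {1..r}"
    and "\<And>i. i \<in> {1..r} \<Longrightarrow> finite (V i) \<and> card (V i) = n i"
  shows "turan_number s (complete_multipartite s r V) (disjoint_copies k (complete_hypergraph s s))
           = (k - 1) * (\<Sum>A | A \<subseteq> {2..r} \<and> card A = s - 1. \<Prod>i\<in>A. n i)"
proof -
  let ?K = "complete_multipartite s r V" and ?F = "disjoint_copies k (complete_hypergraph s s)"
  let ?T = "partial_transversals V s {1..r}" and ?D = "elem_sym (\<lambda>i. card (V i)) (s - 1) ({1..r} - {1})"
  interpret finite_classes V "{1..r}"
    using assms(8,9) by unfold_locales auto
  have edgesK: "edges ?K = ?T"
    by (simp add: complete_multipartite_def partial_transversals_def)
  obtain l where k: "k = Suc l" using assms(3) by (cases k) auto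
  have one: "1 \<in> {1..r}" using assms(1,2) by simp
  have min: "card (V 1) \<le> card (V i)" if "i \<in> {1..r}" for i
    using assms(4,9) one that by (auto simp: mono_on_def)
  have large: "s\<^sup>2 * l \<le> card (V 1)" if "s < r"
  proof -
    have pow: "s\<^sup>2 * l \<le> s ^ 3 * k"
      by (intro mult_mono power_increasing) (use assms(1) k in auto)
    show ?thesis
    proof (cases "s + 1 = r")
      case True
      have "s ^ 3 * k \<le> s ^ 3 * k\<^sup>2" using assms(3) by (simp add: power2_eq_square)
      then show ?thesis using assms(6)[OF True] assms(9)[OF one] pow by linarith
    next
      case False
      then show ?thesis using assms(5) that assms(9)[OF one] pow by fastforce
    qed
  qed
  have "l \<le> card (V 1)"
  proof (cases "s = r")
    case True
    then show ?thesis using assms(7) assms(9)[OF one] k by simp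
  next
    case False
    have "1 * l \<le> s\<^sup>2 * l" by (rule mult_right_mono) (use assms(1) in auto)
    then show ?thesis using large False assms(2) by linarith
  qed
  then obtain S where S: "S \<subseteq> V 1" "card S = l" "finite S"
    using obtain_subset_with_card_n by metis
  have upper: "card E \<le> l * ?D" if "E \<subseteq> ?T" "\<not> has_matching k E" for E
  proof (cases "s = r")
    case True
    have "elem_sym (\<lambda>i. card (V i)) (card ({1..r} - {1})) ({1..r} - {1})
        = (\<Prod>i\<in>{1..r} - {1}. card (V i))"
      by (rule elem_sym_full) simp
    then have "?D = (\<Prod>i\<in>{1..r} - {1}. card (V i))" using True one by simp
    then show ?thesis
      using card_le_if_no_matching_full[OF one min, of E l] that True k by simp
  next
    case False
    then show ?thesis
      using card_le_if_no_matching_large_classes[OF one min assms(1) large, of E] that assms(2) k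
      by simp
  qed
  let ?G = "\<lparr>verts = verts ?K, edges = {e \<in> ?T. \<not> disjnt e S}\<rparr>"
  have uG: "uniform_hypergraph s ?G"
    using finV by (auto simp: uniform_hypergraph_def complete_multipartite_def partial_transversals_def)
  have sG: "subhypergraph ?G ?K"
    by (auto simp: subhypergraph_def edgesK)
       (auto simp: complete_multipartite_def partial_transversals_def)
  have "\<not> has_matching k (edges ?G)"
  proof
    assume "has_matching k (edges ?G)"
    then obtain M where M: "M \<subseteq> edges ?G" "finite M" "card M = k" "pairwise disjnt M"
      unfolding has_matching_def by blast
    have "\<forall>e\<in>M. \<exists>v. v \<in> e \<and> v \<in> S" using M(1) by (auto simp: disjnt_def)
    then obtain x where x: "\<And>e. e \<in> M \<Longrightarrow> x e \<in> e \<and> x e \<in> S" by metis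
    have "inj_on x M"
      using M(4) x unfolding inj_on_def pairwise_def disjnt_def by (metis IntI empty_iff)
    then have "card M \<le> card S" using x S(3) by (metis card_inj_on_le image_subsetI)
    then show False using M(3) S(2) k by simp
  qed
  then have fG: "free_of ?F ?G" using free_of_disjoint_copies_iff[OF uG] assms(1) by simp
  have cG: "card (edges ?G) = l * ?D"
    using card_partial_transversals_meeting[OF one S(1), of "s - 1"] S(2) assms(1)
      card_partial_transversals[OF finite_classes_Diff, of "s - 1" "{1}"] by simp
  have "turan_number s ?K ?F = l * ?D"
    unfolding turan_number_def
  proof (rule Max_eqI)
    let ?N = "{card (edges G) | G. uniform_hypergraph s G \<and> subhypergraph G ?K \<and> free_of ?F G}"
    have "card (edges G) \<le> l * ?D"
      if "uniform_hypergraph s G" "subhypergraph G ?K" "free_of ?F G" for G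
      using upper[of "edges G"] that free_of_disjoint_copies_iff[of s G k] assms(1) edgesK
      by (auto simp: subhypergraph_def)
    then show le: "y \<le> l * ?D" if "y \<in> ?N" for y using that by blast
    then show "finite ?N" by (meson finite_nat_set_iff_bounded_le)
    show "l * ?D \<in> ?N" using uG sG fG cG by (metis (mono_tags, lifting) mem_Collect_eq)
  qed
  moreover have "{1..r} - {1} = {2..r}" by auto
  moreover have "(\<Prod>i\<in>A. card (V i)) = (\<Prod>i\<in>A. n i)" if "A \<subseteq> {2..r}" for A
    using that assms(9) by (intro prod.cong) auto
  ultimately show ?thesis by (simp add: k elem_sym_def)
qed

end
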